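(* Every clopen subset of an lc-compact space is lc-compact (as a subspace).
   Context: No separation axioms are assumed. A subset $A$ of a topological space $X$ is locally closed if for every $x\in A$ there is an open set $U\subseteq X$ such that $x\in U$ and $A\cap U$ is closed in $U$ (equivalently, $A$ is the intersection of an open set and a closed set). A space $X$ is lc-compact if each cover of $X$ by locally closed subsets of $X$ has a finite subcover. *)

theory Defs
  imports "HOL-Analysis.Analysis"
begin

definition locally_closedin :: "'a topology \<Rightarrow> 'a set \<Rightarrow> bool" where
  "locally_closedin X A \<longleftrightarrow> A \<subseteq> topspace X \<and>
     (\<forall>x\<in>A. \<exists>U. openin X U \<and> x \<in> U \<and> closedin (subtopology X U) (A \<inter> U))"

definition lc_compact_space :: "'a topology \<Rightarrow> bool" where
  "lc_compact_space X \<longleftrightarrow>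
     (\<forall>\<U>. (\<forall>A\<in>\<U>. locally_closedin X A) \<and> topspace X \<subseteq> \<Union>\<U>
          \<longrightarrow> (\<exists>\<F>. finite \<F> \<and> \<F> \<subseteq> \<U> \<and> topspace X \<subseteq> \<Union>\<F>))"

end

theory Submission
  imports Defs
begin

text \<open>
  The usual argument that compactness passes to closed subspaces applies, with open covers replaced
  by covers by locally closed sets. Since \<open>C\<close> is open, sets that are locally closed in \<open>C\<close> are
  locally closed in \<open>X\<close>; since \<open>C\<close> is closed, its complement is open, hence locally closed.
  A cover of \<open>C\<close> together with the complement of \<open>C\<close> is therefore an admissible cover of \<open>X\<close>,
  and discarding the complement from a finite subcover leaves a finite subcover of \<open>C\<close>.
\<close>

lemma openin_imp_locally_closedin:
  assumes "openin X W"
  shows "locally_closedin X W"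
  unfolding locally_closedin_def
proof (intro conjI ballI)
  show "W \<subseteq> topspace X"
    using assms by (rule openin_subset)
next
  fix x assume "x \<in> W"
  moreover have "closedin (subtopology X W) (W \<inter> W)"
    using openin_subset[OF assms] closedin_topspace[of "subtopology X W"]
    by (simp add: Int_absorb1)
  ultimately show "\<exists>U. openin X U \<and> x \<in> U \<and> closedin (subtopology X U) (W \<inter> U)"
    using assms by blast
qed

text \<open>
  Local closedness is witnessed by neighbourhoods, and a neighbourhood \<open>U\<close> in an open subspace is
  also a neighbourhood in the whole space, with the same subspace topology on \<open>U\<close>.
\<close>

lemma locally_closedin_open_subtopology:
  assumes "openin X C" and A: "locally_closedin (subtopology X C) A"
  shows "locally_closedin X A"
  unfolding locally_closedin_def
proof (intro conjI ballI)
  show "A \<subseteq> topspace X"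
    using A by (auto simp: locally_closedin_def)
next
  fix x assume "x \<in> A"
  then obtain U where U: "openin (subtopology X C) U" "x \<in> U"
      "closedin (subtopology (subtopology X C) U) (A \<inter> U)"
    using A unfolding locally_closedin_def by blast
  have "openin X U" "U \<subseteq> C"
    using U(1) assms(1) by (auto simp: openin_open_subtopology)
  with U(2,3) show "\<exists>U. openin X U \<and> x \<in> U \<and> closedin (subtopology X U) (A \<inter> U)"
    by (auto simp: subtopology_subtopology Int_absorb1)
qed

theorem proposition4p5:
  fixes X :: "'a topology" and C :: "'a set"
  assumes "lc_compact_space X"
    and "openin X C" and "closedin X C"
  shows "lc_compact_space (subtopology X C)"
  unfolding lc_compact_space_def
proof (intro allI impI)
  fix \<U>
  assume \<U>: "(\<forall>A\<in>\<U>. locally_closedin (subtopology X C) A)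
    \<and> topspace (subtopology X C) \<subseteq> \<Union>\<U>"
  have C: "topspace (subtopology X C) = C"
    using openin_subset[OF assms(2)] by (simp add: Int_absorb1)
  let ?D = "topspace X - C"
  have "openin X ?D"
    using assms(3) by (simp add: closedin_def)
  then have "\<forall>A\<in>insert ?D \<U>. locally_closedin X A"
    using \<U> assms(2) openin_imp_locally_closedin locally_closedin_open_subtopology by blast
  moreover have "topspace X \<subseteq> \<Union>(insert ?D \<U>)"
    using \<U> C by auto
  ultimately obtain \<F> where \<F>: "finite \<F>" "\<F> \<subseteq> insert ?D \<U>" "topspace X \<subseteq> \<Union>\<F>"
    using assms(1) unfolding lc_compact_space_def by meson
  have "C \<subseteq> \<Union>(\<F> - {?D})"
    using \<F>(3) openin_subset[OF assms(2)] by blast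
  with \<F>(1,2) show "\<exists>\<F>. finite \<F> \<and> \<F> \<subseteq> \<U> \<and> topspace (subtopology X C) \<subseteq> \<Union>\<F>"
    by (intro exI[of _ "\<F> - {?D}"]) (auto simp: C simp del: topspace_subtopology)
qed

end
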